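(* Let $n\ge 1$ be an integer. For $i=1,2,\ldots,n$ let $\tau_i=(i,\,n+1)\in\mathfrak S_{n+1}$ be the transposition exchanging $i$ and $n+1$, and let $X_n=\mathrm{Cay}(\mathfrak S_{n+1},\{\tau_1,\tau_2,\ldots,\tau_n\})$. Then $X_n$ is an $\mathfrak S_n$-cover of the complete graph $K_{n+1}$.
   Context: $\mathfrak S_m$ is the symmetric group on $\{1,\dots,m\}$; permutations are composed as functions, $(\xi\tau)(j)=\xi(\tau(j))$. The Cayley graph $\mathrm{Cay}(G,S)$ (with $S=S^{-1}$, $1\notin S$) is the simple undirected graph with vertex set $G$ in which $\xi$ and $\eta$ are adjacent iff $\eta=\xi s$ for some $s\in S$. Cover: for finite simple graphs $\tilde X$ and $X$, $\tilde X$ is a cover of $X$ if there is a surjective graph morphism $p:\tilde X\to X$ such that for every vertex $\tilde v$ of $\tilde X$, $p$ induces a bijection from the set of edges incident to $\tilde v$ to the set of edges incident to $p(\tilde v)$. Galois cover: a cover $p:\tilde X\to X$ is Galois if there is a group $G$ acting on $\tilde X$ (by graph automorphisms) that acts freely and transitively on each fiber $p^{-1}(w)$, $w\in V(X)$, and such that the quotient graph $\tilde X/G$ is isomorphic to $X$. Then $G$ is called the Galois group and $\tilde X$ is called a $G$-cover of $X$ (so "$\mathfrak S_n$-cover" means that the Galois group is isomorphic to $\mathfrak S_n$). The quotient graph $\tilde X/G$ has the $G$-orbits of vertices as vertices, two orbits being adjacent iff some representatives are adjacent in $\tilde X$. *)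

theory Defs
  imports
    "HOL-Combinatorics.Transposition"
    "HOL-Algebra.Group_Action"
    "HOL-Algebra.Sym_Groups"
    "Graph_Theory.Graph_Theory"
begin

text \<open>
  Finite simple undirected graphs are rendered by the locale \<open>pair_graph\<close>: finite, loop-free,
  symmetric digraphs without parallel arcs. An undirected edge is then a pair of opposite arcs,
  and is written below as the two-element set of its endpoints.
\<close>

definition cayley_graph :: "('a, 'b) monoid_scheme \<Rightarrow> 'a set \<Rightarrow> 'a pair_pre_digraph" where
  "cayley_graph G S =
     \<lparr> pverts = carrier G,
       parcs = {(\<xi>, \<eta>). \<xi> \<in> carrier G \<and> \<eta> \<in> carrier G \<and> (\<exists>s\<in>S. \<eta> = \<xi> \<otimes>\<^bsub>G\<^esub> s)} \<rparr>"

definition incident_edges :: "'a pair_pre_digraph \<Rightarrow> 'a \<Rightarrow> 'a set set" where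
  "incident_edges X v = {{v, w} | w. (v, w) \<in> parcs X}"

definition graph_morphism ::
    "('a \<Rightarrow> 'b) \<Rightarrow> 'a pair_pre_digraph \<Rightarrow> 'b pair_pre_digraph \<Rightarrow> bool" where
  "graph_morphism p Y X \<longleftrightarrow>
     (\<forall>v\<in>pverts Y. p v \<in> pverts X) \<and>
     (\<forall>u v. (u, v) \<in> parcs Y \<longrightarrow> (p u, p v) \<in> parcs X)"

definition covering_map ::
    "('a \<Rightarrow> 'b) \<Rightarrow> 'a pair_pre_digraph \<Rightarrow> 'b pair_pre_digraph \<Rightarrow> bool" where
  "covering_map p Y X \<longleftrightarrow>
     pair_graph Y \<and> pair_graph X \<and>
     graph_morphism p Y X \<and> p ` pverts Y = pverts X \<and>
     (\<forall>v\<in>pverts Y. bij_betw (\<lambda>e. p ` e) (incident_edges Y v) (incident_edges X (p v)))"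

definition graph_action ::
    "('g, 'c) monoid_scheme \<Rightarrow> ('g \<Rightarrow> 'a \<Rightarrow> 'a) \<Rightarrow> 'a pair_pre_digraph \<Rightarrow> bool" where
  "graph_action G \<phi> Y \<longleftrightarrow>
     group_action G (pverts Y) \<phi> \<and>
     (\<forall>g\<in>carrier G. \<forall>u\<in>pverts Y. \<forall>v\<in>pverts Y.
        (\<phi> g u, \<phi> g v) \<in> parcs Y \<longleftrightarrow> (u, v) \<in> parcs Y)"

text \<open>
  The case \<open>A = B\<close> is not excluded: an edge inside an orbit gives a loop of the quotient, so a
  quotient isomorphic to a simple graph has no such edges.
\<close>

definition quotient_graph ::
    "('g, 'c) monoid_scheme \<Rightarrow> ('g \<Rightarrow> 'a \<Rightarrow> 'a) \<Rightarrow> 'a pair_pre_digraph \<Rightarrow> 'a set pair_pre_digraph"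
  where
  "quotient_graph G \<phi> Y =
     \<lparr> pverts = orbits G (pverts Y) \<phi>,
       parcs = {(A, B). A \<in> orbits G (pverts Y) \<phi> \<and> B \<in> orbits G (pverts Y) \<phi> \<and>
                  (\<exists>a\<in>A. \<exists>b\<in>B. (a, b) \<in> parcs Y)} \<rparr>"

definition fiber :: "('a \<Rightarrow> 'b) \<Rightarrow> 'a pair_pre_digraph \<Rightarrow> 'b \<Rightarrow> 'a set" where
  "fiber p Y w = {v \<in> pverts Y. p v = w}"

definition galois_covering_map ::
    "('g, 'c) monoid_scheme \<Rightarrow> ('g \<Rightarrow> 'a \<Rightarrow> 'a) \<Rightarrow> ('a \<Rightarrow> 'b) \<Rightarrow>
     'a pair_pre_digraph \<Rightarrow> 'b pair_pre_digraph \<Rightarrow> bool" where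
  "galois_covering_map G \<phi> p Y X \<longleftrightarrow>
     covering_map p Y X \<and>
     graph_action G \<phi> Y \<and>
     (\<forall>w\<in>pverts X.
        (\<forall>g\<in>carrier G. \<forall>v\<in>fiber p Y w. \<phi> g v \<in> fiber p Y w) \<and>
        (\<forall>g\<in>carrier G. \<forall>v\<in>fiber p Y w. \<phi> g v = v \<longrightarrow> g = \<one>\<^bsub>G\<^esub>) \<and>
        (\<forall>u\<in>fiber p Y w. \<forall>v\<in>fiber p Y w. \<exists>g\<in>carrier G. \<phi> g u = v)) \<and>
     digraph_iso (with_proj (quotient_graph G \<phi> Y)) (with_proj X)"

definition galois_cover ::
    "('g, 'c) monoid_scheme \<Rightarrow> 'a pair_pre_digraph \<Rightarrow> 'b pair_pre_digraph \<Rightarrow> bool" where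
  "galois_cover G Y X \<longleftrightarrow> (\<exists>\<phi> p. galois_covering_map G \<phi> p Y X)"

definition star_cayley_graph :: "nat \<Rightarrow> (nat \<Rightarrow> nat) pair_pre_digraph" where
  "star_cayley_graph n =
     cayley_graph (sym_group (n + 1)) {transpose i (n + 1) | i. i \<in> {1..n}}"

end

(*
  The covering map sends a permutation x to x(n+1): the neighbours x \<circ> (i, n+1) of x are
  sent to x(i) for i = 1, ..., n, which are exactly the points other than x(n+1).  (The other
  candidate, the preimage of n+1 under x, is not even a graph morphism.)  The fibres are the left
  cosets of the stabiliser S_n of n+1, so S_n acts simply transitively on them by right
  multiplication with inverses; this preserves adjacency because conjugation by S_n permutes the
  generators.  That the quotient graph is the base is automatic for any covering whose fibres are
  the orbits.
*)
theory Submission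
  imports Defs
begin

section \<open>Coverings and quotients\<close>

text \<open>The covering condition speaks of edges, but for permutations it is the neighbours that
  can be listed. With one endpoint fixed, an edge is recovered from its other endpoint, so a
  bijection of neighbourhoods is enough.\<close>

lemma bij_betw_incident_edges:
  assumes nbr: "bij_betw p {w. (v, w) \<in> parcs Y} {w. (p v, w) \<in> parcs X}"
    and loopfree: "(p v, p v) \<notin> parcs X"
  shows "bij_betw (\<lambda>e. p ` e) (incident_edges Y v) (incident_edges X (p v))"
proof -
  have adj: "(p v, p w) \<in> parcs X" if "(v, w) \<in> parcs Y" for w
    using nbr that by (auto simp: bij_betw_def)
  have "inj_on (\<lambda>e. p ` e) (incident_edges Y v)"
  proof (rule inj_onI)
    fix e e' assume "e \<in> incident_edges Y v" "e' \<in> incident_edges Y v" and eq: "p ` e = p ` e'"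
    then obtain w w' where w: "e = {v, w}" "(v, w) \<in> parcs Y" and w': "e' = {v, w'}" "(v, w') \<in> parcs Y"
      by (auto simp: incident_edges_def)
    have "p w \<noteq> p v" "p w' \<noteq> p v" using adj[OF w(2)] adj[OF w'(2)] loopfree by auto
    then have "p w = p w'" using eq w w' by (auto simp: doubleton_eq_iff)
    then have "w = w'" using nbr w(2) w'(2) by (auto simp: bij_betw_def dest: inj_onD)
    then show "e = e'" using w w' by simp
  qed
  moreover have "(\<lambda>e. p ` e) ` incident_edges Y v = incident_edges X (p v)"
  proof -
    have "(\<lambda>e. p ` e) ` incident_edges Y v = (\<lambda>w. {p v, w}) ` p ` {w. (v, w) \<in> parcs Y}"
      by (auto simp: incident_edges_def image_iff) blast+
    also have "\<dots> = incident_edges X (p v)"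
      using nbr by (auto simp: incident_edges_def bij_betw_def)
    finally show ?thesis .
  qed
  ultimately show ?thesis by (simp add: bij_betw_def)
qed

text \<open>Surjectivity on incident edges supplies an edge over \<open>{p v, w}\<close>, and
  comparing endpoints identifies its far end. Through this lemma every arc of the base appears in
  the quotient.\<close>

lemma covering_map_lift_arc:
  assumes cov: "covering_map p Y X" and v: "v \<in> pverts Y" and arc: "(p v, w) \<in> parcs X"
  obtains u where "(v, u) \<in> parcs Y" "p u = w"
proof -
  interpret X: pair_graph X using cov by (simp add: covering_map_def)
  have "{p v, w} \<in> incident_edges X (p v)" using arc by (auto simp: incident_edges_def)
  then have "{p v, w} \<in> (\<lambda>e. p ` e) ` incident_edges Y v"
    using cov v by (simp add: covering_map_def bij_betw_def)
  then obtain u where u: "(v, u) \<in> parcs Y" "{p v, w} = {p v, p u}"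
    by (auto simp: incident_edges_def)
  moreover have "p u = w" using u(2) by (auto simp: doubleton_eq_iff)
  ultimately show ?thesis using that by blast
qed

text \<open>In \<open>with_proj\<close> the arcs are the pairs themselves, so the vertex map
  \<open>h\<close> dictates the arc map \<open>map_prod h h\<close>, and tail and head on the target
  side are again \<open>fst\<close> and \<open>snd\<close>.\<close>

lemma digraph_iso_with_projI:
  assumes wf: "pair_wf_digraph X" and bij: "bij_betw h (pverts X) (pverts Q)"
    and arcs: "parcs Q = map_prod h h ` parcs X"
  shows "digraph_iso (with_proj X) (with_proj Q)"
proof -
  let ?h = "\<lparr>iso_verts = h, iso_arcs = map_prod h h, iso_head = snd, iso_tail = fst\<rparr>"
  have sub: "parcs X \<subseteq> pverts X \<times> pverts X"
    using pair_wf_digraph.in_arcsD1[OF wf] pair_wf_digraph.in_arcsD2[OF wf] by auto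
  have inj: "inj_on h (pverts X)" using bij by (simp add: bij_betw_def)
  have "inj_on (map_prod h h) (parcs X)"
    using map_prod_inj_on[OF inj inj] sub by (rule inj_on_subset)
  then have "pre_digraph.digraph_isomorphism (with_proj X) ?h"
    using wf inj by (auto simp: pre_digraph.digraph_isomorphism_def wf_digraph_wp_iff)
  moreover have "with_proj Q = app_iso ?h (with_proj X)"
    using bij arcs by (simp add: with_proj_def app_iso_def bij_betw_def)
  ultimately show ?thesis by (auto simp: digraph_iso_def)
qed

lemma galois_covering_mapI:
  assumes cov: "covering_map p Y X" and act: "graph_action G \<phi> Y"
    and inv: "\<And>g v. g \<in> carrier G \<Longrightarrow> v \<in> pverts Y \<Longrightarrow> p (\<phi> g v) = p v"
    and free: "\<And>g v. g \<in> carrier G \<Longrightarrow> v \<in> pverts Y \<Longrightarrow> \<phi> g v = v \<Longrightarrow> g = \<one>\<^bsub>G\<^esub>"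
    and trans: "\<And>u v. u \<in> pverts Y \<Longrightarrow> v \<in> pverts Y \<Longrightarrow> p u = p v \<Longrightarrow> \<exists>g\<in>carrier G. \<phi> g u = v"
  shows "galois_covering_map G \<phi> p Y X"
proof -
  interpret X: pair_graph X using cov by (simp add: covering_map_def)
  interpret Y: pair_graph Y using cov by (simp add: covering_map_def)
  interpret group_action G "pverts Y" \<phi> using act by (simp add: graph_action_def)
  have surj: "pverts X = p ` pverts Y" using cov by (simp add: covering_map_def)
  \<comment> \<open>Invariance of \<open>p\<close> puts the orbit inside the fibre; transitivity
    gives the converse.\<close>
  have orbit: "Group_Action.orbit G \<phi> v = fiber p Y (p v)" if "v \<in> pverts Y" for v
    using inv[OF _ that] trans[OF that] element_image[OF _ that]
    by (fastforce simp: Group_Action.orbit_def fiber_def)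
  have "orbits G (pverts Y) \<phi> = (\<lambda>v. fiber p Y (p v)) ` pverts Y"
    using orbit by (auto simp: orbits_def)
  then have verts: "pverts (quotient_graph G \<phi> Y) = fiber p Y ` pverts X"
    by (simp add: quotient_graph_def surj image_image)
  \<comment> \<open>Fibres over distinct vertices differ because \<open>p\<close> is surjective, so
    none of them is empty.\<close>
  have "inj_on (fiber p Y) (pverts X)"
    unfolding surj by (rule inj_onI) (auto simp: fiber_def)
  then have bij: "bij_betw (fiber p Y) (pverts X) (pverts (quotient_graph G \<phi> Y))"
    by (simp add: bij_betw_def verts)
  have "(fiber p Y w, fiber p Y w') \<in> parcs (quotient_graph G \<phi> Y)" if arc: "(w, w') \<in> parcs X" for w w'
  proof -
    have ww: "w \<in> pverts X" "w' \<in> pverts X" using X.wellformed' arc by auto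
    then obtain v where v: "v \<in> pverts Y" "p v = w" using surj by auto
    then obtain u where u: "(v, u) \<in> parcs Y" "p u = w'"
      using covering_map_lift_arc[OF cov] arc by blast
    then show ?thesis
      using v ww Y.in_arcsD2[OF u(1)] verts by (auto simp: quotient_graph_def fiber_def)
  qed
  moreover have "\<exists>w w'. (w, w') \<in> parcs X \<and> A = fiber p Y w \<and> B = fiber p Y w'"
    if arc: "(A, B) \<in> parcs (quotient_graph G \<phi> Y)" for A B
  proof -
    from arc have "A \<in> pverts (quotient_graph G \<phi> Y)" "B \<in> pverts (quotient_graph G \<phi> Y)"
      by (auto simp: quotient_graph_def)
    then obtain w w' where w: "A = fiber p Y w" "B = fiber p Y w'" unfolding verts by blast
    from arc obtain a b where "a \<in> A" "b \<in> B" "(a, b) \<in> parcs Y" by (auto simp: quotient_graph_def)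
    then have "(w, w') \<in> parcs X"
      using cov w by (auto simp: covering_map_def graph_morphism_def fiber_def)
    then show ?thesis using w by blast
  qed
  ultimately have "parcs (quotient_graph G \<phi> Y) = map_prod (fiber p Y) (fiber p Y) ` parcs X"
    by (auto simp: image_iff) (metis map_prod_simp)
  then have "digraph_iso (with_proj X) (with_proj (quotient_graph G \<phi> Y))"
    using digraph_iso_with_projI[OF X.pair_wf_digraph_axioms bij] by blast
  \<comment> \<open>The isomorphism is built from the base to the quotient, where
    \<open>fiber p Y\<close> is an explicit formula, and is then reversed.\<close>
  then have "digraph_iso (with_proj (quotient_graph G \<phi> Y)) (with_proj X)"
    using digraph_iso_swap X.wf_digraph by blast
  then show ?thesis
    unfolding galois_covering_map_def fiber_def
    using cov act inv free trans element_image[OF _ _ refl] by auto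
qed

section \<open>Cayley graphs\<close>

text \<open>Excluding the identity from \<open>S\<close> rules out loops; closure under inverses
  gives symmetry, as the arc from \<open>x\<close> to \<open>x s\<close> is retraced by the inverse
  of \<open>s\<close>.\<close>

lemma pair_graph_cayley_graph:
  assumes "group G" and fin: "finite (carrier G)" and S: "S \<subseteq> carrier G" "\<one>\<^bsub>G\<^esub> \<notin> S"
    and inv: "\<And>s. s \<in> S \<Longrightarrow> inv\<^bsub>G\<^esub> s \<in> S"
  shows "pair_graph (cayley_graph G S)"
proof -
  interpret group G by fact
  have sub: "parcs (cayley_graph G S) \<subseteq> carrier G \<times> carrier G" by (auto simp: cayley_graph_def)
  then have "finite (parcs (cayley_graph G S))" using fin by (meson finite_SigmaI finite_subset)
  moreover have "symmetric (with_proj (cayley_graph G S))"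
    unfolding symmetric_def with_proj_simps
  proof (rule symI)
    fix x y assume "(x, y) \<in> parcs (cayley_graph G S)"
    then obtain s where s: "s \<in> S" "x \<in> carrier G" and y: "y = x \<otimes>\<^bsub>G\<^esub> s"
      by (auto simp: cayley_graph_def)
    have sG: "s \<in> carrier G" using s S(1) by blast
    then have "y \<in> carrier G" "x = y \<otimes>\<^bsub>G\<^esub> inv\<^bsub>G\<^esub> s" using s(2) by (simp_all add: y m_assoc)
    then show "(y, x) \<in> parcs (cayley_graph G S)"
      using s(2) inv[OF s(1)] by (simp add: cayley_graph_def) blast
  qed
  moreover have "fst e \<noteq> snd e" if "e \<in> parcs (cayley_graph G S)" for e
    using that S by (auto simp: cayley_graph_def)
  moreover have "pverts (cayley_graph G S) = carrier G" by (simp add: cayley_graph_def)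
  ultimately show ?thesis
    using fin sub by unfold_locales auto
qed

text \<open>The inverse turns right multiplication into a left action. The restriction to
  \<open>carrier G\<close> is there because the elements of \<open>BijGroup\<close> are extensional
  functions. The map \<open>j\<close> lets a group act through a homomorphism, later an
  inclusion.\<close>

definition right_mult_action ::
    "('a, 'b) monoid_scheme \<Rightarrow> ('g \<Rightarrow> 'a) \<Rightarrow> 'g \<Rightarrow> 'a \<Rightarrow> 'a" where
  "right_mult_action G j h = (\<lambda>x\<in>carrier G. x \<otimes>\<^bsub>G\<^esub> inv\<^bsub>G\<^esub> (j h))"

lemma group_action_right_mult_action:
  assumes "group_hom H G j"
  shows "group_action H (carrier G) (right_mult_action G j)"
proof -
  interpret group_hom H G j by fact
  have Bij: "right_mult_action G j h \<in> Bij (carrier G)" if "h \<in> carrier H" for h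
  proof -
    have "bij_betw (right_mult_action G j h) (carrier G) (carrier G)"
      by (rule bij_betw_byWitness[where f' = "\<lambda>x. x \<otimes>\<^bsub>G\<^esub> j h"])
        (use that in \<open>auto simp: right_mult_action_def H.m_assoc\<close>)
    then show ?thesis by (simp add: Bij_def right_mult_action_def)
  qed
  have "right_mult_action G j (g \<otimes>\<^bsub>H\<^esub> h)
      = compose (carrier G) (right_mult_action G j g) (right_mult_action G j h)"
    if "g \<in> carrier H" "h \<in> carrier H" for g h
    using that by (auto simp: right_mult_action_def compose_def H.inv_mult_group H.m_assoc)
  then have "right_mult_action G j \<in> hom H (BijGroup (carrier G))"
    using Bij by (auto simp: hom_def BijGroup_def)
  then show ?thesis
    by (simp add: group_action_def group_hom_def group_hom_axioms_def group_BijGroup)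
qed

text \<open>Writing \<open>k\<close> for \<open>j h\<close>, one has
  \<open>x s k^-1 = (x k^-1) (k s k^-1)\<close>: translating an arc replaces its generator by a
  conjugate, which lies in \<open>S\<close> again.\<close>

lemma graph_action_right_mult_action:
  assumes hom: "group_hom H G j" and S: "S \<subseteq> carrier G"
    and conj: "\<And>h s. h \<in> carrier H \<Longrightarrow> s \<in> S \<Longrightarrow> j h \<otimes>\<^bsub>G\<^esub> s \<otimes>\<^bsub>G\<^esub> inv\<^bsub>G\<^esub> (j h) \<in> S"
  shows "graph_action H (right_mult_action G j) (cayley_graph G S)"
proof -
  interpret group_hom H G j by fact
  let ?\<phi> = "right_mult_action G j" and ?C = "cayley_graph G S"
  interpret act: group_action H "carrier G" ?\<phi>
    by (rule group_action_right_mult_action[OF hom])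
  have arc: "(?\<phi> h x, ?\<phi> h y) \<in> parcs ?C" if h: "h \<in> carrier H" and xy: "(x, y) \<in> parcs ?C" for h x y
  proof -
    obtain s where s: "s \<in> S" "x \<in> carrier G" "y = x \<otimes>\<^bsub>G\<^esub> s" using xy by (auto simp: cayley_graph_def)
    then have "?\<phi> h y = ?\<phi> h x \<otimes>\<^bsub>G\<^esub> (j h \<otimes>\<^bsub>G\<^esub> s \<otimes>\<^bsub>G\<^esub> inv\<^bsub>G\<^esub> (j h))"
      using h S by (auto simp: right_mult_action_def H.m_assoc H.inv_solve_left subset_iff)
    moreover have "?\<phi> h x \<in> carrier G" "?\<phi> h y \<in> carrier G"
      using xy act.element_image[OF h _ refl] by (simp_all add: cayley_graph_def)
    ultimately show ?thesis
      unfolding cayley_graph_def using conj[OF h s(1)] by simp blast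
  qed
  \<comment> \<open>Arcs are also reflected: apply the preservation just shown to the inverse of
    \<open>h\<close>.\<close>
  have "(x, y) \<in> parcs ?C"
    if h: "h \<in> carrier H" and xy: "x \<in> carrier G" "y \<in> carrier G" "(?\<phi> h x, ?\<phi> h y) \<in> parcs ?C" for h x y
    using arc[OF _ xy(3), of "inv\<^bsub>H\<^esub> h"] h act.orbit_sym_aux[OF h _ refl] xy by simp
  moreover have "pverts ?C = carrier G" by (simp add: cayley_graph_def)
  ultimately show ?thesis
    unfolding graph_action_def using arc act.group_action_axioms by metis
qed

lemma sym_group_inv:
  assumes "x \<in> carrier (sym_group n)"
  shows "inv\<^bsub>sym_group n\<^esub> x = inv' x"
proof -
  interpret group "sym_group n" by (rule sym_group_is_group)
  show ?thesis
    using assms permutes_inv permutes_inv_o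
    by (intro inv_equality) (auto simp: sym_group_carrier sym_group_mult sym_group_one)
qed

section \<open>The star transpositions\<close>

lemma conj_transpose:
  assumes "bij f"
  shows "f \<circ> transpose a b \<circ> inv' f = transpose (f a) (f b)"
proof
  fix x
  obtain y where "x = f y" using assms by (metis bij_pointE)
  then show "(f \<circ> transpose a b \<circ> inv' f) x = transpose (f a) (f b) x"
    using assms by (simp add: bij_is_inj transpose_apply_commute inv_f_f transpose_def inj_eq)
qed

abbreviation star_transpositions :: "nat \<Rightarrow> (nat \<Rightarrow> nat) set" where
  "star_transpositions n \<equiv> {transpose i (n + 1) | i. i \<in> {1..n}}"

lemma star_transpositions_subset: "star_transpositions n \<subseteq> carrier (sym_group (n + 1))"
  by (auto simp: sym_group_carrier intro!: permutes_swap_id)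

lemma pair_graph_star_cayley_graph: "pair_graph (star_cayley_graph n)"
  unfolding star_cayley_graph_def
proof (rule pair_graph_cayley_graph)
  show "finite (carrier (sym_group (n + 1)))"
    by (simp add: sym_group_def finite_permutations)
  show "\<one>\<^bsub>sym_group (n + 1)\<^esub> \<notin> star_transpositions n"
    by (auto simp: sym_group_one transpose_eq_id_iff dest: sym)
  show "inv\<^bsub>sym_group (n + 1)\<^esub> s \<in> star_transpositions n" if "s \<in> star_transpositions n" for s
    using that star_transpositions_subset[of n] by (auto simp: sym_group_inv subset_iff)
qed (use star_transpositions_subset sym_group_is_group in auto)

text \<open>A permutation in \<open>sym_group n\<close> is a function on all of \<open>nat\<close>
  fixing every point outside \<open>{1..n}\<close>, so the inclusion as the stabiliser of
  \<open>n + 1\<close> is literally the identity map.\<close>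

lemma sym_group_incl_hom: "group_hom (sym_group n) (sym_group (n + 1)) (\<lambda>x. x)"
proof -
  have "x permutes {1..n + 1}" if "x permutes {1..n}" for x
    using permutes_subset[OF that] by auto
  then show ?thesis
    by (auto simp: group_hom_def group_hom_axioms_def sym_group_is_group hom_def
        sym_group_carrier sym_group_mult)
qed

lemma graph_action_star_cayley_graph:
  "graph_action (sym_group n) (right_mult_action (sym_group (n + 1)) (\<lambda>x. x)) (star_cayley_graph n)"
  unfolding star_cayley_graph_def
proof (rule graph_action_right_mult_action[OF sym_group_incl_hom star_transpositions_subset])
  fix h s assume h: "h \<in> carrier (sym_group n)" and "s \<in> star_transpositions n"
  then obtain i where i: "s = transpose i (n + 1)" "i \<in> {1..n}" by auto
  have perm: "h permutes {1..n}" using h by (simp add: sym_group_carrier)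
  have "h \<in> carrier (sym_group (n + 1))" using group_hom.hom_closed[OF sym_group_incl_hom] h by blast
  \<comment> \<open>\<open>h\<close> fixes \<open>n + 1\<close>, so conjugation moves only the other
    point of the transposition.\<close>
  moreover have "h \<circ> s \<circ> inv' h = transpose (h i) (n + 1)"
    using conj_transpose[OF permutes_bij[OF perm], of i "n + 1"] permutes_not_in[OF perm, of "n + 1"] i
    by simp
  moreover have "h i \<in> {1..n}" using permutes_in_image[OF perm] i by blast
  ultimately show "h \<otimes>\<^bsub>sym_group (n + 1)\<^esub> s \<otimes>\<^bsub>sym_group (n + 1)\<^esub> inv\<^bsub>sym_group (n + 1)\<^esub> h
      \<in> star_transpositions n"
    by (auto simp: sym_group_mult sym_group_inv)
qed

lemma star_cayley_graph_neighbours: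
  assumes "x permutes {1..n + 1}"
  shows "{y. (x, y) \<in> parcs (star_cayley_graph n)} = (\<lambda>i. x \<circ> transpose i (n + 1)) ` {1..n}"
proof -
  have "x \<circ> transpose i (n + 1) permutes {1..n + 1}" if "i \<in> {1..n}" for i
    using that by (intro permutes_compose permutes_swap_id assms) auto
  then show ?thesis
    using assms
    by (fastforce simp: star_cayley_graph_def cayley_graph_def sym_group_carrier sym_group_mult)
qed

theorem theorem1:
  fixes n :: nat and K :: "'v pair_pre_digraph"
  assumes "n \<ge> 1"
    and "complete_digraph (n + 1) (with_proj K)"
  shows "galois_cover (sym_group n) (star_cayley_graph n) K"
proof -
  let ?N = "{1..n + 1}"
  have K: "finite (pverts K)" "card (pverts K) = n + 1"
    and arcs: "parcs K = {(u, v). (u, v) \<in> pverts K \<times> pverts K \<and> u \<noteq> v}"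
    using assms(2) by (simp_all add: complete_digraph_pair_def)
  \<comment> \<open>\<open>K\<close> is any complete graph on \<open>n + 1\<close> vertices;
    \<open>f\<close> labels its vertices by the points permuted.\<close>
  obtain f where f: "bij_betw f ?N (pverts K)"
    using finite_same_card_bij[of ?N "pverts K"] K by auto
  let ?p = "\<lambda>x. f (x (n + 1))"
  have verts: "pverts (star_cayley_graph n) = {x. x permutes ?N}"
    by (simp add: star_cayley_graph_def cayley_graph_def sym_group_def)
  have bij: "bij_betw (\<lambda>i. f (x i)) ?N (pverts K)" if "x permutes ?N" for x
    using bij_betw_trans[OF permutes_imp_bij[OF that] f] by (simp add: o_def)
  have p_in: "?p x \<in> pverts K" if "x permutes ?N" for x
    using bij_betwE[OF bij[OF that]] by simp
  have nbr: "bij_betw ?p {y. (x, y) \<in> parcs (star_cayley_graph n)} {w. (?p x, w) \<in> parcs K}"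
    if x: "x permutes ?N" for x
  proof -
    have N: "?N - {n + 1} = {1..n}" by auto
    have target: "{w. (?p x, w) \<in> parcs K} = pverts K - {?p x}"
      using p_in[OF x] by (auto simp: arcs)
    \<comment> \<open>Deleting \<open>n + 1\<close> from the domain deletes exactly
      \<open>?p x\<close> from the image, and what remains is the neighbourhood of
      \<open>?p x\<close> in a complete graph.\<close>
    have "bij_betw (\<lambda>i. f (x i)) {1..n} (pverts K - {?p x})"
      using bij_betw_DiffI[OF bij[OF x], of "{n + 1}" "{?p x}"] p_in[OF x] unfolding N
      by (simp add: bij_betw_def)
    then have b: "bij_betw (?p \<circ> (\<lambda>i. x \<circ> transpose i (n + 1))) {1..n} {w. (?p x, w) \<in> parcs K}"
      by (simp add: o_def target del: One_nat_def)
    \<comment> \<open>Injectivity of the composite passes to its first factor, which therefore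
      indexes the neighbours of \<open>x\<close> bijectively and can be cancelled.\<close>
    then have "inj_on (\<lambda>i. x \<circ> transpose i (n + 1)) {1..n}"
      unfolding bij_betw_def by (blast dest: inj_on_imageI2)
    then show ?thesis
      unfolding star_cayley_graph_neighbours[OF x] using b
      by (simp add: bij_betw_comp_iff[OF inj_on_imp_bij_betw])
  qed
  have cov: "covering_map ?p (star_cayley_graph n) K"
    unfolding covering_map_def graph_morphism_def
  proof (intro conjI ballI allI impI)
    show "pair_graph (star_cayley_graph n)" by (rule pair_graph_star_cayley_graph)
    show "pair_graph K" using assms(2) by (rule pair_graphI_complete)
    show "?p x \<in> pverts K" if "x \<in> pverts (star_cayley_graph n)" for x
      using p_in that verts by simp
    show "(?p x, ?p y) \<in> parcs K" if "(x, y) \<in> parcs (star_cayley_graph n)" for x y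
    proof -
      have "x permutes ?N"
        using that by (simp add: star_cayley_graph_def cayley_graph_def sym_group_def)
      from bij_betwE[OF nbr[OF this]] show ?thesis using that by blast
    qed
    show "?p ` pverts (star_cayley_graph n) = pverts K"
    proof (intro equalityI subsetI)
      fix w assume "w \<in> pverts K"
      then obtain i where i: "i \<in> ?N" "w = f i" using f unfolding bij_betw_def by blast
      \<comment> \<open>This permutation sends \<open>n + 1\<close> to \<open>i\<close>, so it lies
        over \<open>f i\<close>; for \<open>i = n + 1\<close> it is the identity.\<close>
      have "transpose i (n + 1) permutes ?N" using i by (intro permutes_swap_id) auto
      then show "w \<in> ?p ` pverts (star_cayley_graph n)"
        using i by (auto simp: verts image_iff intro!: exI[of _ "transpose i (n + 1)"])
    qed (use p_in verts in auto)
    show "bij_betw ((`) ?p) (incident_edges (star_cayley_graph n) x) (incident_edges K (?p x))"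
      if "x \<in> pverts (star_cayley_graph n)" for x
      by (rule bij_betw_incident_edges) (use nbr that verts arcs in auto)
  qed
  interpret incl: group_hom "sym_group n" "sym_group (n + 1)" "\<lambda>x. x" by (rule sym_group_incl_hom)
  let ?\<phi> = "right_mult_action (sym_group (n + 1)) (\<lambda>x. x)"
  have \<phi>: "?\<phi> h x = x \<circ> inv' h" if "h \<in> carrier (sym_group n)" "x permutes ?N" for h x
    using that incl.hom_closed[OF that(1)]
    by (simp add: right_mult_action_def sym_group_inv sym_group_mult) (simp add: sym_group_carrier)
  have "galois_covering_map (sym_group n) ?\<phi> ?p (star_cayley_graph n) K"
  proof (rule galois_covering_mapI[OF cov graph_action_star_cayley_graph])
    fix h x assume h: "h \<in> carrier (sym_group n)" and "x \<in> pverts (star_cayley_graph n)"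
    then have x: "x permutes ?N" and hp: "h permutes {1..n}" by (simp_all add: verts sym_group_carrier)
    show "?p (?\<phi> h x) = ?p x"
      using permutes_not_in[OF permutes_inv[OF hp], of "n + 1"] unfolding \<phi>[OF h x] by simp
    show "h = \<one>\<^bsub>sym_group n\<^esub>" if "?\<phi> h x = x"
    proof -
      have "inv' h a = a" for a
        using that permutes_inj[OF x] unfolding \<phi>[OF h x] by (simp add: fun_eq_iff inj_eq)
      then have "h a = a" for a using permutes_inverses(1)[OF hp, of a] by simp
      then show ?thesis by (auto simp: sym_group_one)
    qed
  next
    fix x y assume "x \<in> pverts (star_cayley_graph n)" "y \<in> pverts (star_cayley_graph n)"
      and eq: "?p x = ?p y"
    then have x: "x permutes ?N" and y: "y permutes ?N" by (simp_all add: verts)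
    have "x (n + 1) \<in> ?N" "y (n + 1) \<in> ?N"
      using permutes_in_image[OF x, of "n + 1"] permutes_in_image[OF y, of "n + 1"] by auto
    then have same: "x (n + 1) = y (n + 1)"
      using eq f by (auto simp: bij_betw_def dest: inj_onD)
    \<comment> \<open>The solution for \<open>h\<close> of the equation
      \<open>x \<circ> inv' h = y\<close>.\<close>
    let ?h = "inv' y \<circ> x"
    have "?h permutes ?N" by (intro permutes_compose permutes_inv x y)
    \<comment> \<open>Agreement of \<open>x\<close> and \<open>y\<close> at \<open>n + 1\<close> is
      what brings \<open>?h\<close> down from the larger symmetric group into
      \<open>sym_group n\<close>.\<close>
    moreover have "?h (n + 1) = n + 1" using same permutes_inverses(2)[OF y] by simp
    then have "?h a = a" if "a \<in> ?N - {1..n}" for a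
      using that by (metis DiffD1 DiffD2 atLeastAtMost_iff le_SucE Suc_eq_plus1)
    ultimately have h: "?h permutes {1..n}" by (rule permutes_superset)
    have "inv' ?h = inv' x \<circ> y"
      using permutes_bij[OF x] permutes_bij[OF y] by (simp add: o_inv_distrib bij_imp_bij_inv inv_inv_eq)
    then have "?\<phi> ?h x = y"
      using \<phi>[OF _ x, of ?h] h permutes_inverses(1)[OF x] by (auto simp: sym_group_carrier)
    then show "\<exists>g\<in>carrier (sym_group n). ?\<phi> g x = y" using h sym_group_carrier by blast
  qed
  then show ?thesis unfolding galois_cover_def by blast
qed

end
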